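(* Let $\mathcal J$ be an ideal on $\omega$ which is a $P^+(\mathcal J)$-ideal and is $\le_{KB}$-homogeneous. (1) Assume CH. The following conditions are equivalent: (a) $\mathcal{ED}_{\mathrm{Fin}}\not\le_{KB}\mathcal J$; (b) there is a Q-point which is not a $\mathcal J$-point; (c) there is a Q-point which is not a weak $\mathcal J$-ultrafilter. (2) If $\mathcal J$ is $F_\sigma$, then CH can be relaxed to the assumption $\mathfrak p=\mathfrak c$ in (1).
   Context: An ideal on a set $X$ is a family of subsets of $X$ closed under finite unions and subsets, containing all finite subsets of $X$ and not containing $X$; $\mathcal J^+=\mathcal P(X)\setminus\mathcal J$. $F_\sigma$ refers to the topology of $\mathcal P(\omega)\cong\{0,1\}^\omega$. $\mathfrak c=2^{\aleph_0}$, and $\mathfrak p$ is the usual pseudointersection number. With $\Delta=\{(n,k)\in\omega^2:n\ge k\}$, $\mathcal{ED}_{\mathrm{Fin}}=\{A\subseteq\Delta:\exists m\ \forall n\ |\{k:(n,k)\in A\}|<m\}$, an ideal on $\Delta$. For ideals $\mathcal I$ on $X$ and $\mathcal K$ on $Y$, $\mathcal I\le_{KB}\mathcal K$ ($\mathcal I\le_P\mathcal K$) means that there is a finite-to-one (one-to-one, respectively) function $f:Y\to X$ with $f^{-1}[B]\in\mathcal K$ for all $B\in\mathcal I$. $\mathcal J$ is a $P^+(\mathcal J)$-ideal if for each decreasing sequence $A_0\supseteq A_1\supseteq\dots$ of sets from $\mathcal J^+$ there is $B\in\mathcal J^+$ with $B\setminus A_n\in\mathcal J$ for all $n$. For $A\in\mathcal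 J^+$, $\mathcal J\restriction A=\{B\cap A:B\in\mathcal J\}$ (an ideal on $A$); $\mathcal J$ is $\le_{KB}$-homogeneous if $\mathcal J\restriction A\le_{KB}\mathcal J$ and $\mathcal J\le_{KB}\mathcal J\restriction A$ for every $A\in\mathcal J^+$. Ultrafilters on $\omega$ contain all cofinite sets; $\mathcal U^*=\{\omega\setminus A:A\in\mathcal U\}$. $\mathcal U$ is a weak $\mathcal J$-ultrafilter ($\mathcal J$-point) if $\mathcal J\not\le_{KB}\mathcal U^*$ ($\mathcal J\not\le_P\mathcal U^*$, respectively). $\mathcal U$ is a Q-point if for each partition $\{A_n:n\in\omega\}$ of $\omega$ into finite sets there is $A\in\mathcal U$ with $|A\cap A_n|=1$ for each $n$. *)

theory Defs
  imports "HOL-Analysis.Analysis" "HOL-Library.Disjoint_Sets"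
begin

unbundle cardinal_syntax

definition ideal_on :: "'a set \<Rightarrow> 'a set set \<Rightarrow> bool" where
  "ideal_on X I \<longleftrightarrow>
     I \<subseteq> Pow X \<and>
     (\<forall>A\<in>I. \<forall>B\<in>I. A \<union> B \<in> I) \<and>
     (\<forall>A\<in>I. \<forall>B. B \<subseteq> A \<longrightarrow> B \<in> I) \<and>
     (\<forall>A. A \<subseteq> X \<and> finite A \<longrightarrow> A \<in> I) \<and>
     X \<notin> I"

definition positive_sets :: "'a set \<Rightarrow> 'a set set \<Rightarrow> 'a set set" where
  "positive_sets X I = Pow X - I"

definition restrict_ideal :: "'a set set \<Rightarrow> 'a set \<Rightarrow> 'a set set" where
  "restrict_ideal I A = {B \<inter> A | B. B \<in> I}"

definition KB_le :: "'a set \<Rightarrow> 'a set set \<Rightarrow> 'b set \<Rightarrow> 'b set set \<Rightarrow> bool" where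
  "KB_le X I Y K \<longleftrightarrow>
     (\<exists>f. f \<in> Y \<rightarrow> X \<and> (\<forall>x\<in>X. finite (f -` {x} \<inter> Y)) \<and> (\<forall>B\<in>I. f -` B \<inter> Y \<in> K))"

definition P_le :: "'a set \<Rightarrow> 'a set set \<Rightarrow> 'b set \<Rightarrow> 'b set set \<Rightarrow> bool" where
  "P_le X I Y K \<longleftrightarrow>
     (\<exists>f. f \<in> Y \<rightarrow> X \<and> inj_on f Y \<and> (\<forall>B\<in>I. f -` B \<inter> Y \<in> K))"

definition KB_homogeneous :: "'a set \<Rightarrow> 'a set set \<Rightarrow> bool" where
  "KB_homogeneous X J \<longleftrightarrow>
     (\<forall>A\<in>positive_sets X J.
        KB_le A (restrict_ideal J A) X J \<and> KB_le X J A (restrict_ideal J A))"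

text \<open>A \<open>P\<^sup>+(J)\<close>-ideal: the pseudointersection is taken modulo \<open>J\<close> itself, not modulo finite sets.\<close>

definition P_plus_ideal :: "'a set \<Rightarrow> 'a set set \<Rightarrow> bool" where
  "P_plus_ideal X J \<longleftrightarrow>
     (\<forall>A :: nat \<Rightarrow> 'a set. decseq A \<and> (\<forall>n. A n \<in> positive_sets X J) \<longrightarrow>
        (\<exists>B\<in>positive_sets X J. \<forall>n. B - A n \<in> J))"

definition Delta :: "(nat \<times> nat) set" where
  "Delta = {(n, k). n \<ge> k}"

definition ED_Fin :: "(nat \<times> nat) set set" where
  "ED_Fin = {A. A \<subseteq> Delta \<and> (\<exists>m. \<forall>n. card {k. (n, k) \<in> A} < m)}"

text \<open>Ultrafilters on \<open>\<omega>\<close> are nonprincipal: they contain all cofinite sets.\<close>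

definition ultrafilter :: "nat set set \<Rightarrow> bool" where
  "ultrafilter U \<longleftrightarrow>
     {} \<notin> U \<and>
     (\<forall>A\<in>U. \<forall>B\<in>U. A \<inter> B \<in> U) \<and>
     (\<forall>A\<in>U. \<forall>B. A \<subseteq> B \<longrightarrow> B \<in> U) \<and>
     (\<forall>A. A \<in> U \<or> - A \<in> U) \<and>
     (\<forall>A. finite (- A) \<longrightarrow> A \<in> U)"

definition dual_ideal :: "nat set set \<Rightarrow> nat set set" where
  "dual_ideal U = {- A | A. A \<in> U}"

definition weak_ultrafilter :: "nat set set \<Rightarrow> nat set set \<Rightarrow> bool" where
  "weak_ultrafilter J U \<longleftrightarrow> ultrafilter U \<and> \<not> KB_le UNIV J UNIV (dual_ideal U)"

definition ideal_point :: "nat set set \<Rightarrow> nat set set \<Rightarrow> bool" where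
  "ideal_point J U \<longleftrightarrow> ultrafilter U \<and> \<not> P_le UNIV J UNIV (dual_ideal U)"

definition Q_point :: "nat set set \<Rightarrow> bool" where
  "Q_point U \<longleftrightarrow> ultrafilter U \<and>
     (\<forall>A :: nat \<Rightarrow> nat set.
        partition_on UNIV (range A) \<and> (\<forall>n. finite (A n)) \<longrightarrow>
        (\<exists>S\<in>U. \<forall>n. card (S \<inter> A n) = 1))"

text \<open>The topology is that of \<open>{0,1}\<^sup>\<omega>\<close>: subsets of \<open>\<omega>\<close> are identified with their characteristic
  functions \<open>nat \<Rightarrow> bool\<close>, whose type carries the product of the discrete topologies.\<close>

definition F_sigma_family :: "nat set set \<Rightarrow> bool" where
  "F_sigma_family J \<longleftrightarrow> fsigma ((\<lambda>A n. n \<in> A) ` J)"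

definition continuum :: "(nat \<Rightarrow> bool) rel" where
  "continuum = ctwo ^c natLeq"

definition CH :: bool where
  "CH \<longleftrightarrow> continuum =o cardSuc natLeq"

definition strong_FIP :: "nat set set \<Rightarrow> bool" where
  "strong_FIP F \<longleftrightarrow> (\<forall>G. G \<subseteq> F \<and> finite G \<longrightarrow> infinite (\<Inter>G))"

definition has_pseudointersection :: "nat set set \<Rightarrow> bool" where
  "has_pseudointersection F \<longleftrightarrow> (\<exists>P. infinite P \<and> (\<forall>A\<in>F. finite (P - A)))"

definition pseudointersection_number :: "nat set rel" where
  "pseudointersection_number =
     (let R = {|F| | F. strong_FIP F \<and> \<not> has_pseudointersection F}
      in SOME r. r \<in> R \<and> (\<forall>r'\<in>R. r \<le>o r'))"

text \<open>The choice above is well-defined up to \<open>=o\<close>: a family of least cardinality exists.\<close>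

lemma ex_strong_FIP_no_pseudointersection:
  "\<exists>F. strong_FIP F \<and> \<not> has_pseudointersection F"
proof -
  have "\<exists>M\<in>Collect strong_FIP. \<forall>F\<in>Collect strong_FIP. M \<subseteq> F \<longrightarrow> F = M"
  proof (rule subset_Zorn_nonempty)
    have "strong_FIP {}"
      by (simp add: strong_FIP_def)
    then show "Collect strong_FIP \<noteq> {}"
      by blast
  next
    fix C assume C: "C \<noteq> {}" "subset.chain (Collect strong_FIP) C"
    have "infinite (\<Inter>G)" if G: "G \<subseteq> \<Union>C" "finite G" for G
    proof -
      obtain B where "B \<in> C" "G \<subseteq> B"
        using finite_subset_Union_chain[OF G(2,1) C] .
      moreover have "strong_FIP B"
        using C(2) \<open>B \<in> C\<close> by (auto simp: subset.chain_def)
      ultimately show ?thesis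
        using G(2) by (auto simp: strong_FIP_def)
    qed
    then show "\<Union>C \<in> Collect strong_FIP"
      by (simp add: strong_FIP_def)
  qed
  then obtain M where M: "strong_FIP M" and max: "\<And>F. strong_FIP F \<Longrightarrow> M \<subseteq> F \<Longrightarrow> F = M"
    by blast
  have "\<not> has_pseudointersection M"
  proof
    assume "has_pseudointersection M"
    then obtain P where P: "infinite P" "\<And>A. A \<in> M \<Longrightarrow> finite (P - A)"
      by (auto simp: has_pseudointersection_def)
    have mem: "Q \<in> M" if Q: "Q \<subseteq> P" "infinite Q" for Q
    proof -
      have "infinite (\<Inter>G)" if G: "G \<subseteq> insert Q M" "finite G" for G
      proof
        assume fin: "finite (\<Inter>G)"
        have "finite (\<Union>A\<in>G - {Q}. P - A)"
          using G P(2) by (intro finite_UN_I) auto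
        moreover have "Q \<subseteq> (\<Union>A\<in>G - {Q}. P - A) \<union> \<Inter>G"
          using Q(1) by blast
        ultimately show False
          using fin Q(2) by (meson finite_UnI finite_subset)
      qed
      then have "insert Q M = M"
        by (intro max) (auto simp: strong_FIP_def)
      then show ?thesis by blast
    qed
    obtain Q1 Q2 where "infinite Q1" "infinite Q2" "Q1 \<subseteq> P" "Q2 \<subseteq> P" "Q1 \<inter> Q2 = {}"
    proof
      let ?e = "enumerate P"
      have inj: "inj ?e"
        using P(1) by (simp add: strict_mono_enumerate strict_mono_imp_inj_on)
      show "infinite (?e ` (range (\<lambda>n. 2 * n)))" "infinite (?e ` (range (\<lambda>n. 2 * n + 1)))"
        using inj by (auto simp: finite_image_iff inj_on_subset range_inj_infinite inj_on_def)
      show "?e ` (range (\<lambda>n. 2 * n)) \<subseteq> P" "?e ` (range (\<lambda>n. 2 * n + 1)) \<subseteq> P"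
        using P(1) by (auto simp: enumerate_in_set)
      have "2 * m \<noteq> 2 * n + 1" for m n :: nat by presburger
      then show "?e ` (range (\<lambda>n. 2 * n)) \<inter> ?e ` (range (\<lambda>n. 2 * n + 1)) = {}"
        by (auto simp: inj_eq[OF inj])
    qed
    then have "{Q1, Q2} \<subseteq> M" "\<Inter>{Q1, Q2} = {}"
      using mem by auto
    with M show False
      unfolding strong_FIP_def by (metis finite.emptyI finite_insert)
  qed
  with M show ?thesis by blast
qed

lemma pseudointersection_number:
  shows "\<exists>F. strong_FIP F \<and> \<not> has_pseudointersection F \<and> pseudointersection_number = |F|"
    and "strong_FIP F \<Longrightarrow> \<not> has_pseudointersection F \<Longrightarrow> pseudointersection_number \<le>o |F|"
proof -
  let ?R = "{|F| | F. strong_FIP F \<and> \<not> has_pseudointersection F}"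
  have "\<exists>r\<in>?R. \<forall>r'\<in>?R. r \<le>o r'"
    using ex_strong_FIP_no_pseudointersection
    by (intro exists_minim_Card_order) (auto simp: card_of_Card_order)
  then have "\<exists>r. r \<in> ?R \<and> (\<forall>r'\<in>?R. r \<le>o r')"
    by blast
  from someI_ex[OF this]
  have *: "pseudointersection_number \<in> ?R \<and> (\<forall>r'\<in>?R. pseudointersection_number \<le>o r')"
    unfolding pseudointersection_number_def Let_def .
  show "\<exists>F. strong_FIP F \<and> \<not> has_pseudointersection F \<and> pseudointersection_number = |F|"
    using * by blast
  show "strong_FIP F \<Longrightarrow> \<not> has_pseudointersection F \<Longrightarrow> pseudointersection_number \<le>o |F|"
    using * by blast
qed

end

theory Submission
  imports Defs "HOL-Library.Countable_Set_Type"
begin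

text \<open>
  Everything is phrased through finite-to-one functions \<open>f :: nat \<Rightarrow> nat\<close>, which are the same
  thing as partitions of \<open>\<omega>\<close> into finite sets: \<open>U\<close> is a Q-point iff every such \<open>f\<close> is injective
  on a member of \<open>U\<close> (\<open>Q_point_iff_inj_on\<close>).

  The implications that need no set-theoretic hypothesis are short. If \<open>f\<close> witnesses that a
  Q-point is not a weak \<open>J\<close>-ultrafilter, then \<open>f\<close> is injective on a member of the ultrafilter, and
  there it coincides with an injection of all of \<open>\<omega>\<close>; hence weak \<open>J\<close>-ultrafilters and \<open>J\<close>-points
  coincide among Q-points. If in addition \<open>g\<close> witnesses \<open>ED_Fin \<le> J\<close>, then \<open>g \<circ> f\<close> pulls back the
  columns of \<open>Delta\<close> to finite sets; a member of the Q-point meeting each of these at most once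
  has its image in \<open>ED_Fin\<close>, so its complement would be in the ultrafilter as well.

  For the converse, the Q-point is built inside the \<open>J\<close>-positive sets, so that the identity
  witnesses that it is not a \<open>J\<close>-point. A single step is possible by homogeneity: if a positive set
  \<open>B\<close> had no positive subset on which the finite-to-one \<open>f\<close> is injective, then arranging
  the fibres of \<open>f\<close> in the columns of \<open>Delta\<close> would show \<open>ED_Fin \<le> J\<restriction>B \<le> J\<close>
  (\<open>positive_subset_inj_on\<close>). The steps are iterated along a well-order of
  \<open>\<omega>\<^sup>\<omega>\<close> whose proper initial segments have size less than \<open>\<cc>\<close>, each new set being almost
  contained, modulo \<open>J\<close>, in all the earlier ones. What keeps this going is a lower bound, modulo
  \<open>J\<close>, for every family of fewer than \<open>\<cc>\<close> positive sets whose finite intersections are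
  positive. Under CH the family is countable and the bound is the \<open>P\<^sup>+(J)\<close> property. If \<open>J\<close> is
  \<open>F\<^sub>\<sigma>\<close> and \<open>\<pp> = \<cc>\<close>, the bound is the union of a pseudointersection of a family
  of sets of finite sets; the \<open>F\<^sub>\<sigma>\<close> hypothesis enters because positivity is then witnessed by
  countably many conditions on finite subsets.
\<close>

section \<open>Ideals and ultrafilters\<close>

definition finite_to_one :: "('a \<Rightarrow> 'b) \<Rightarrow> bool" where
  "finite_to_one f \<longleftrightarrow> (\<forall>y. finite (f -` {y}))"

lemma ideal_on_subset: "ideal_on X J \<Longrightarrow> A \<in> J \<Longrightarrow> B \<subseteq> A \<Longrightarrow> B \<in> J"
  unfolding ideal_on_def by blast

lemma ideal_on_Un: "ideal_on X J \<Longrightarrow> A \<in> J \<Longrightarrow> B \<in> J \<Longrightarrow> A \<union> B \<in> J"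
  unfolding ideal_on_def by blast

lemma ideal_on_UNIV_finite: "ideal_on UNIV J \<Longrightarrow> finite A \<Longrightarrow> A \<in> J"
  unfolding ideal_on_def by blast

lemma ideal_on_UNIV_notin: "ideal_on UNIV J \<Longrightarrow> UNIV \<notin> J"
  unfolding ideal_on_def by blast

lemma ideal_on_UN:
  assumes "ideal_on UNIV J" "finite S" "\<And>s. s \<in> S \<Longrightarrow> A s \<in> J"
  shows "(\<Union>s\<in>S. A s) \<in> J"
  using assms(2,3)
  by (induction S rule: finite_induct)
    (auto intro: ideal_on_UNIV_finite[OF assms(1)] ideal_on_Un[OF assms(1)])

lemma ultrafilter_superset: "ultrafilter U \<Longrightarrow> A \<in> U \<Longrightarrow> A \<subseteq> B \<Longrightarrow> B \<in> U"
  unfolding ultrafilter_def by blast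

lemma ultrafilter_Int: "ultrafilter U \<Longrightarrow> A \<in> U \<Longrightarrow> B \<in> U \<Longrightarrow> A \<inter> B \<in> U"
  unfolding ultrafilter_def by blast

lemma ultrafilter_Compl: "ultrafilter U \<Longrightarrow> A \<notin> U \<Longrightarrow> - A \<in> U"
  unfolding ultrafilter_def by blast

lemma ultrafilter_not_both: "ultrafilter U \<Longrightarrow> A \<in> U \<Longrightarrow> - A \<in> U \<Longrightarrow> False"
  unfolding ultrafilter_def by (metis Compl_disjoint)

lemma ultrafilter_infinite:
  assumes "ultrafilter U" "A \<in> U"
  shows "infinite A"
proof
  assume "finite A"
  then have "- A \<in> U"
    using assms(1) unfolding ultrafilter_def by (metis double_compl)
  then show False
    using ultrafilter_not_both assms by blast
qed

lemma dual_ideal_iff: "A \<in> dual_ideal U \<longleftrightarrow> - A \<in> U"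
  unfolding dual_ideal_def by (auto intro: exI[of _ "- A"])

lemma KB_le_UNIV:
  "KB_le UNIV I UNIV K \<longleftrightarrow> (\<exists>f. finite_to_one f \<and> (\<forall>B\<in>I. f -` B \<in> K))"
  unfolding KB_le_def finite_to_one_def by simp

lemma P_le_UNIV:
  "P_le UNIV I UNIV K \<longleftrightarrow> (\<exists>f. inj f \<and> (\<forall>B\<in>I. f -` B \<in> K))"
  unfolding P_le_def by simp

lemma inj_imp_finite_to_one: "inj f \<Longrightarrow> finite_to_one f"
  unfolding finite_to_one_def by (simp add: finite_vimageI)

lemma KB_le_trans:
  assumes "KB_le X I Y K" "KB_le Y K Z L"
  shows "KB_le X I Z L"
proof -
  obtain f where f: "f \<in> Y \<rightarrow> X" "\<And>x. x \<in> X \<Longrightarrow> finite (f -` {x} \<inter> Y)"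
    "\<And>B. B \<in> I \<Longrightarrow> f -` B \<inter> Y \<in> K"
    using assms(1) unfolding KB_le_def by blast
  obtain g where g: "g \<in> Z \<rightarrow> Y" "\<And>y. y \<in> Y \<Longrightarrow> finite (g -` {y} \<inter> Z)"
    "\<And>B. B \<in> K \<Longrightarrow> g -` B \<inter> Z \<in> L"
    using assms(2) unfolding KB_le_def by blast
  have "finite ((f \<circ> g) -` {x} \<inter> Z)" if "x \<in> X" for x
  proof -
    have "(f \<circ> g) -` {x} \<inter> Z \<subseteq> (\<Union>y\<in>f -` {x} \<inter> Y. g -` {y} \<inter> Z)"
      using g(1) by auto
    moreover have "finite (\<Union>y\<in>f -` {x} \<inter> Y. g -` {y} \<inter> Z)"
      using f(2)[OF that] g(2) by blast
    ultimately show ?thesis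
      by (rule finite_subset)
  qed
  moreover have "(f \<circ> g) -` B \<inter> Z \<in> L" if "B \<in> I" for B
  proof -
    have "(f \<circ> g) -` B \<inter> Z = g -` (f -` B \<inter> Y) \<inter> Z"
      using g(1) by auto
    then show ?thesis
      using g(3)[OF f(3)[OF that]] by simp
  qed
  ultimately show ?thesis
    unfolding KB_le_def using f(1) g(1) by (intro exI[of _ "f \<circ> g"]) auto
qed

section \<open>Q-points\<close>

lemma Q_point_inj_on:
  fixes f :: "nat \<Rightarrow> 'b"
  assumes "Q_point U" "finite_to_one f"
  shows "\<exists>S\<in>U. inj_on f S"
proof -
  let ?A = "\<lambda>n. f -` {f n}"
  have "partition_on UNIV (range ?A)"
    by (auto simp: partition_on_def disjoint_def)
  moreover have "\<forall>n. finite (?A n)"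
    using assms(2) unfolding finite_to_one_def by blast
  ultimately obtain S where S: "S \<in> U" "\<And>n. card (S \<inter> ?A n) = 1"
    using assms(1) unfolding Q_point_def by metis
  have "x = y" if "x \<in> S" "y \<in> S" "f x = f y" for x y
  proof -
    have "x \<in> S \<inter> ?A x" "y \<in> S \<inter> ?A x"
      using that by auto
    moreover obtain z where "S \<inter> ?A x = {z}"
      using S(2)[of x] card_1_singletonE by metis
    ultimately show ?thesis
      by (metis singletonD)
  qed
  then show ?thesis
    using S(1) unfolding inj_on_def by blast
qed

text \<open>From right to left: a member of the ultrafilter meeting each block at most once becomes a transversal after
  adding a point of each block that it misses.\<close>

lemma Q_point_iff_inj_on:
  "Q_point U \<longleftrightarrow>
     ultrafilter U \<and> (\<forall>f :: nat \<Rightarrow> nat. finite_to_one f \<longrightarrow> (\<exists>S\<in>U. inj_on f S))"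
proof
  assume "Q_point U"
  then show "ultrafilter U \<and> (\<forall>f :: nat \<Rightarrow> nat. finite_to_one f \<longrightarrow> (\<exists>S\<in>U. inj_on f S))"
    using Q_point_inj_on unfolding Q_point_def by blast
next
  assume *: "ultrafilter U \<and> (\<forall>f :: nat \<Rightarrow> nat. finite_to_one f \<longrightarrow> (\<exists>S\<in>U. inj_on f S))"
  have "\<exists>S\<in>U. \<forall>n. card (S \<inter> A n) = 1"
    if part: "partition_on UNIV (range A)" and fin: "\<And>n. finite (A n)"
    for A :: "nat \<Rightarrow> nat set"
  proof -
    have cover: "\<exists>n. x \<in> A n" for x
      using part unfolding partition_on_def by blast
    have ne: "A n \<noteq> {}" for n
      using part unfolding partition_on_def by (metis rangeI)
    have same: "A n = A m" if "x \<in> A n" "x \<in> A m" for x n m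
      using part that unfolding partition_on_def disjoint_def by blast
    define f where "f x = (LEAST n. x \<in> A n)" for x
    have f: "x \<in> A (f x)" for x
      unfolding f_def using cover by (metis LeastI)
    have f_le: "f x \<le> n" if "x \<in> A n" for x n
      unfolding f_def using that by (rule Least_le)
    have "finite_to_one f"
      unfolding finite_to_one_def
    proof
      fix n
      have "f -` {n} \<subseteq> A n"
        using f by auto
      then show "finite (f -` {n})"
        using fin finite_subset by blast
    qed
    then obtain T where T: "T \<in> U" "inj_on f T"
      using * by blast
    define e where "e P = (SOME x. x \<in> P \<and> (T \<inter> P \<noteq> {} \<longrightarrow> x \<in> T))" for P
    have e: "e (A n) \<in> A n \<and> (T \<inter> A n \<noteq> {} \<longrightarrow> e (A n) \<in> T)" for n
    proof -
      have "\<exists>x. x \<in> A n \<and> (T \<inter> A n \<noteq> {} \<longrightarrow> x \<in> T)"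
        using ne[of n] by (cases "T \<inter> A n = {}") auto
      then show ?thesis
        unfolding e_def by (rule someI_ex)
    qed
    let ?S = "range (\<lambda>n. e (A n))"
    have "T \<subseteq> ?S"
    proof
      fix x assume x: "x \<in> T"
      let ?y = "e (A (f x))"
      have y: "?y \<in> A (f x)" "?y \<in> T"
        using e[of "f x"] f[of x] x by auto
      have "x \<in> A (f ?y)"
        using same[OF f y(1)] f[of x] by simp
      then have "f ?y = f x"
        using y(1) f_le by (meson antisym)
      then show "x \<in> ?S"
        using T(2) x y(2) unfolding inj_on_def by (metis rangeI)
    qed
    then have "?S \<in> U"
      using * T(1) ultrafilter_superset by blast
    moreover have "?S \<inter> A n = {e (A n)}" for n
    proof -
      have "e (A m) = e (A n)" if "e (A m) \<in> A n" for m
        using same[OF _ that] e[of m] by metis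
      then show ?thesis
        using e[of n] by auto
    qed
    ultimately show ?thesis
      by (intro bexI[of _ ?S]) auto
  qed
  then show "Q_point U"
    using * unfolding Q_point_def by blast
qed

section \<open>The implications that hold in ZFC\<close>

text \<open>If \<open>S\<close> is split into two infinite halves, then one half still belongs to the ultrafilter, and
  the image of the other leaves enough room to continue injectively.\<close>

lemma inj_on_large_set_extends:
  fixes f :: "nat \<Rightarrow> nat"
  assumes U: "ultrafilter U" and S: "S \<in> U" and f: "inj_on f S"
  shows "\<exists>g. inj g \<and> (\<exists>T\<in>U. \<forall>x\<in>T. g x = f x)"
proof -
  obtain A B where AB: "A \<subseteq> S" "B \<subseteq> S" "infinite A" "infinite B" "A \<inter> B = {}"
    using infinite_split ultrafilter_infinite[OF U S] by metis
  have "\<exists>T D. T \<in> U \<and> T \<subseteq> S \<and> D \<subseteq> S \<and> infinite D \<and> T \<inter> D = {}"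
  proof (cases "A \<in> U")
    case True
    then show ?thesis
      using AB by blast
  next
    case False
    then have "S - A \<in> U"
      using ultrafilter_Int[OF U S ultrafilter_Compl[OF U]] by (simp add: Diff_eq)
    then show ?thesis
      using AB(1,3) by blast
  qed
  then obtain T D where T: "T \<in> U" "T \<subseteq> S" and D: "D \<subseteq> S" "infinite D" "T \<inter> D = {}"
    by blast
  let ?R = "- (f ` T)"
  have "f ` D \<subseteq> ?R"
    using f T(2) D unfolding inj_on_def by blast
  moreover have "infinite (f ` D)"
    using D f by (meson finite_imageD inj_on_subset)
  ultimately have R: "infinite ?R"
    using infinite_super by blast
  define g where "g x = (if x \<in> T then f x else enumerate ?R x)" for x
  have out: "enumerate ?R x \<noteq> f y" if "y \<in> T" for x y
    using enumerate_in_set[OF R, of x] that by auto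
  have "inj (enumerate ?R)"
    using R by (simp add: strict_mono_enumerate strict_mono_imp_inj_on)
  then have "g x = g y \<Longrightarrow> x = y" for x y
    using out[of x y] out[of y x] inj_on_subset[OF f T(2)]
    unfolding g_def by (auto split: if_splits dest: inj_onD injD)
  then have "inj g"
    by (rule injI)
  moreover have "\<forall>x\<in>T. g x = f x"
    by (simp add: g_def)
  ultimately show ?thesis
    using T(1) by blast
qed

lemma Q_point_ideal_point_iff_weak:
  assumes Q: "Q_point U"
  shows "ideal_point J U \<longleftrightarrow> weak_ultrafilter J U"
proof -
  have U: "ultrafilter U"
    using Q unfolding Q_point_def by blast
  have "P_le UNIV J UNIV (dual_ideal U) \<longleftrightarrow> KB_le UNIV J UNIV (dual_ideal U)"
  proof
    show "KB_le UNIV J UNIV (dual_ideal U)" if "P_le UNIV J UNIV (dual_ideal U)"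
      using that inj_imp_finite_to_one unfolding KB_le_UNIV P_le_UNIV by blast
  next
    assume "KB_le UNIV J UNIV (dual_ideal U)"
    then obtain f where f: "finite_to_one f" "\<And>B. B \<in> J \<Longrightarrow> - (f -` B) \<in> U"
      unfolding KB_le_UNIV dual_ideal_iff by blast
    obtain S where "S \<in> U" "inj_on f S"
      using Q_point_inj_on[OF Q f(1)] by blast
    then obtain g T where g: "inj g" "T \<in> U" "\<And>x. x \<in> T \<Longrightarrow> g x = f x"
      using inj_on_large_set_extends[OF U] by metis
    have "- (g -` B) \<in> U" if "B \<in> J" for B
    proof (rule ultrafilter_superset[OF U])
      show "T \<inter> - (f -` B) \<in> U"
        using ultrafilter_Int[OF U] g(2) f(2)[OF that] .
      show "T \<inter> - (f -` B) \<subseteq> - (g -` B)"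
        using g(3) by auto
    qed
    then show "P_le UNIV J UNIV (dual_ideal U)"
      using g(1) unfolding P_le_UNIV dual_ideal_iff by blast
  qed
  then show ?thesis
    unfolding ideal_point_def weak_ultrafilter_def by blast
qed

lemma Q_point_not_above_ED_Fin:
  assumes Q: "Q_point U"
  shows "\<not> KB_le Delta ED_Fin UNIV (dual_ideal U)"
proof
  have U: "ultrafilter U"
    using Q unfolding Q_point_def by blast
  assume "KB_le Delta ED_Fin UNIV (dual_ideal U)"
  then obtain g where g: "\<And>x. g x \<in> Delta" "\<And>d. d \<in> Delta \<Longrightarrow> finite (g -` {d})"
    "\<And>B. B \<in> ED_Fin \<Longrightarrow> - (g -` B) \<in> U"
    unfolding KB_le_def dual_ideal_iff by auto
  have "finite_to_one (fst \<circ> g)"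
    unfolding finite_to_one_def
  proof
    fix n
    have "(fst \<circ> g) -` {n} \<subseteq> (\<Union>k\<le>n. g -` {(n, k)})"
    proof
      fix x assume "x \<in> (fst \<circ> g) -` {n}"
      then show "x \<in> (\<Union>k\<le>n. g -` {(n, k)})"
        using g(1)[of x] by (cases "g x") (auto simp: Delta_def)
    qed
    moreover have "finite (\<Union>k\<le>n. g -` {(n, k)})"
      using g(2) by (auto simp: Delta_def)
    ultimately show "finite ((fst \<circ> g) -` {n})"
      by (rule finite_subset)
  qed
  then obtain S where S: "S \<in> U" "inj_on (fst \<circ> g) S"
    using Q_point_inj_on[OF Q] by blast
  have "card {k. (n, k) \<in> g ` S} < 2" for n
  proof -
    have "k = l" if kl: "(n, k) \<in> g ` S" "(n, l) \<in> g ` S" for k l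
    proof -
      obtain x y where xy: "x \<in> S" "y \<in> S" "g x = (n, k)" "g y = (n, l)"
        using kl unfolding image_iff by metis
      then have "(fst \<circ> g) x = (fst \<circ> g) y"
        by simp
      then have "x = y"
        by (rule inj_onD[OF S(2) _ xy(1,2)])
      then show ?thesis
        using xy by simp
    qed
    then have "\<exists>k. {k. (n, k) \<in> g ` S} \<subseteq> {k}"
      by (cases "{k. (n, k) \<in> g ` S} = {}") auto
    then obtain k where "{k. (n, k) \<in> g ` S} \<subseteq> {k}"
      by auto
    then have "card {k. (n, k) \<in> g ` S} \<le> card {k}"
      by (intro card_mono) auto
    then show ?thesis
      by simp
  qed
  then have "g ` S \<in> ED_Fin"
    using g(1) unfolding ED_Fin_def by blast
  then have "- (g -` (g ` S)) \<in> U"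
    by (rule g(3))
  then have "- S \<in> U"
    using ultrafilter_superset[OF U] by blast
  then show False
    using ultrafilter_not_both[OF U S(1)] by blast
qed

section \<open>Positive sets on which a finite-to-one function is injective\<close>

text \<open>A point \<open>x\<close> of \<open>B\<close> is placed at height \<open>x\<close> in a column that depends only on \<open>f x\<close>, the sum of
  the fibre of \<open>x\<close> being a column that is long enough. This placement is injective, so it
  pulls some set of \<open>ED_Fin\<close> back to a positive set; a set with fewer than \<open>m\<close> points in every
  column is a union of \<open>m\<close> sets with at most one point in every column, and one of these is
  positive. Different fibres may share a column, which does no harm.\<close>

lemma positive_subset_inj_on_if_not_above_ED_Fin:
  fixes J :: "nat set set" and f :: "nat \<Rightarrow> nat"
  assumes J: "ideal_on UNIV J"
    and B: "\<not> KB_le Delta ED_Fin B (restrict_ideal J B)"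
    and f: "finite_to_one f"
  shows "\<exists>C\<subseteq>B. C \<notin> J \<and> inj_on f C"
proof -
  define c where "c x = \<Sum>(f -` {f x})" for x
  have c_f: "f x = f y \<Longrightarrow> c x = c y" for x y
    by (simp add: c_def)
  have "x \<le> c x" for x
    unfolding c_def using f unfolding finite_to_one_def
    by (intro member_le_sum[of x _ "\<lambda>x. x"]) auto
  then have "(\<lambda>x. (c x, x)) \<in> B \<rightarrow> Delta"
    by (auto simp: Delta_def)
  moreover have "finite ((\<lambda>x. (c x, x)) -` {d} \<inter> B)" for d
  proof -
    have "(\<lambda>x. (c x, x)) -` {d} \<inter> B \<subseteq> {snd d}"
      by auto
    then show ?thesis
      using finite_subset by blast
  qed
  ultimately obtain D where D: "D \<in> ED_Fin" "(\<lambda>x. (c x, x)) -` D \<inter> B \<notin> restrict_ideal J B"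
    using B unfolding KB_le_def by blast
  define Y where "Y = (\<lambda>x. (c x, x)) -` D \<inter> B"
  have "Y \<notin> J"
    using D(2) unfolding Y_def restrict_ideal_def by blast
  obtain m where m: "\<And>n. card {k. (n, k) \<in> D} < m"
    using D(1) unfolding ED_Fin_def by blast
  have fin: "finite {k. (n, k) \<in> D}" for n
    by (rule finite_subset[of _ "{..n}"]) (use D(1) in \<open>auto simp: ED_Fin_def Delta_def\<close>)
  define rk where "rk x = card {y \<in> Y. c y = c x \<and> y < x}" for x
  have sub: "{y \<in> Y. c y = c x \<and> y < x} \<subseteq> {k. (c x, k) \<in> D}" for x
    unfolding Y_def by auto
  have "rk x < m" for x
    using card_mono[OF fin sub] m unfolding rk_def by (meson le_less_trans)
  then have "Y = (\<Union>i<m. {x \<in> Y. rk x = i})"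
    by auto
  then obtain i where i: "{x \<in> Y. rk x = i} \<notin> J"
    using ideal_on_UN[OF J, of "{..<m}" "\<lambda>i. {x \<in> Y. rk x = i}"] \<open>Y \<notin> J\<close> by auto
  have lt: "rk x < rk y" if "x \<in> Y" "c x = c y" "x < y" for x y
    unfolding rk_def
  proof (rule psubset_card_mono)
    show "finite {z \<in> Y. c z = c y \<and> z < y}"
      using finite_subset[OF sub fin] .
    show "{z \<in> Y. c z = c x \<and> z < x} \<subset> {z \<in> Y. c z = c y \<and> z < y}"
      using that by auto
  qed
  have "inj_on f {x \<in> Y. rk x = i}"
  proof (rule inj_onI)
    fix x y assume "x \<in> {x \<in> Y. rk x = i}" "y \<in> {x \<in> Y. rk x = i}" "f x = f y"
    then show "x = y"
      using lt[of x y] lt[of y x] c_f[of x y] by (cases x y rule: linorder_cases) auto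
  qed
  then show ?thesis
    using i unfolding Y_def by (intro exI[of _ "{x \<in> Y. rk x = i}"]) (auto simp: Y_def)
qed

lemma positive_subset_inj_on:
  fixes J :: "nat set set" and f :: "nat \<Rightarrow> nat"
  assumes J: "ideal_on UNIV J" and hom: "KB_homogeneous UNIV J"
    and ED: "\<not> KB_le Delta ED_Fin UNIV J"
    and "B \<notin> J" "finite_to_one f"
  shows "\<exists>C\<subseteq>B. C \<notin> J \<and> inj_on f C"
proof (rule positive_subset_inj_on_if_not_above_ED_Fin[OF J _ assms(5)])
  have "KB_le B (restrict_ideal J B) UNIV J"
    using hom \<open>B \<notin> J\<close> unfolding KB_homogeneous_def positive_sets_def by blast
  then show "\<not> KB_le Delta ED_Fin B (restrict_ideal J B)"
    using ED KB_le_trans by blast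
qed

section \<open>Lower bounds modulo \<open>J\<close> for small families\<close>

definition positive_FIP :: "nat set set \<Rightarrow> nat set set \<Rightarrow> bool" where
  "positive_FIP J F \<longleftrightarrow> (\<forall>G. G \<subseteq> F \<and> finite G \<longrightarrow> \<Inter>G \<notin> J)"

definition has_lower_bound_mod :: "nat set set \<Rightarrow> nat set set \<Rightarrow> bool" where
  "has_lower_bound_mod J F \<longleftrightarrow> (\<exists>B. B \<notin> J \<and> (\<forall>A\<in>F. B - A \<in> J))"

lemma continuum_eq: "continuum = |UNIV :: (nat \<Rightarrow> bool) set|"
proof -
  have "Func (UNIV :: nat set) (UNIV :: bool set) = UNIV"
    by (auto simp: Func_def)
  then show ?thesis
    by (simp add: continuum_def cexp_def ctwo_def Field_card_of Field_natLeq)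
qed

lemma countable_lower_bound_mod:
  assumes J: "ideal_on UNIV J" and P: "P_plus_ideal UNIV J"
    and "countable F" and F: "positive_FIP J F"
  shows "has_lower_bound_mod J F"
proof (cases "F = {}")
  case True
  then show ?thesis
    using ideal_on_UNIV_notin[OF J] unfolding has_lower_bound_mod_def by blast
next
  case False
  define A where "A n = (\<Inter>i\<le>n. from_nat_into F i)" for n
  have "A n \<notin> J" for n
    using F False unfolding positive_FIP_def A_def
    by (metis finite_atMost finite_imageI from_nat_into image_subset_iff)
  moreover have "decseq A"
    unfolding decseq_def A_def by (intro allI impI INT_anti_mono) auto
  ultimately obtain B where B: "B \<notin> J" "\<And>n. B - A n \<in> J"
    using P unfolding P_plus_ideal_def positive_sets_def by auto
  have "B - X \<in> J" if X: "X \<in> F" for X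
  proof -
    obtain n where "X = from_nat_into F n"
      using from_nat_into_surj[OF \<open>countable F\<close> X] by metis
    then have "B - X \<subseteq> B - A n"
      unfolding A_def by auto
    then show ?thesis
      using ideal_on_subset[OF J B(2)] by blast
  qed
  then show ?thesis
    using B(1) unfolding has_lower_bound_mod_def by blast
qed

lemma CH_lower_bound_mod:
  assumes "CH" "ideal_on UNIV J" "P_plus_ideal UNIV J" "|F| <o continuum" "positive_FIP J F"
  shows "has_lower_bound_mod J F"
proof (rule countable_lower_bound_mod[OF assms(2,3) _ assms(5)])
  have "|F| <o cardSuc natLeq"
    using assms(1,4) unfolding CH_def using ordLess_ordIso_trans by blast
  then have "|F| \<le>o natLeq"
    using cardSuc_ordLeq_ordLess[OF natLeq_Card_order card_of_Card_order] by blast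
  then show "countable F"
    by (simp add: countable_card_le_natLeq)
qed

lemma compact_UNIV_bool_fun: "compact (UNIV :: ('a \<Rightarrow> bool) set)"
proof -
  have "compact (UNIV :: bool set)"
    by (simp add: finite_imp_compact)
  then have "compact_space (product_topology (\<lambda>i :: 'a. euclidean :: bool topology) UNIV)"
    unfolding compact_space_product_topology by (simp add: compact_space_def)
  then show ?thesis
    unfolding euclidean_product_topology compact_space_def by simp
qed

text \<open>The members of a closed set that contain \<open>A \<inter> {..<k}\<close> form a closed set, decreasing in \<open>k\<close>;
  by compactness, if all of these are nonempty, then a single member contains all of \<open>A\<close>.\<close>

lemma closed_family_superset:
  fixes C :: "(nat \<Rightarrow> bool) set"
  assumes C: "closed C"
    and ex: "\<And>k. \<exists>y\<in>C. A \<inter> {..<k} \<subseteq> {i. y i}"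
  shows "\<exists>y\<in>C. A \<subseteq> {i. y i}"
proof -
  let ?K = "\<lambda>i. C \<inter> {y. y i}"
  have cl: "closed (?K i)" for i
  proof -
    have "closed ((\<lambda>y :: nat \<Rightarrow> bool. y i) -` {True})"
      by (intro closed_vimage continuous_on_product_coordinates) simp
    moreover have "(\<lambda>y :: nat \<Rightarrow> bool. y i) -` {True} = {y. y i}"
      by auto
    ultimately show ?thesis
      using C by (simp add: closed_Int)
  qed
  have "C \<inter> (\<Inter>i\<in>A. ?K i) \<noteq> {}"
  proof (rule compact_imp_fip_image)
    show "compact C"
      using compact_Int_closed[OF compact_UNIV_bool_fun C] by simp
    show "closed (?K i)" for i
      by (rule cl)
  next
    fix I assume I: "finite I" "I \<subseteq> A"
    obtain y where y: "y \<in> C" "A \<inter> {..<Suc (Max I)} \<subseteq> {i. y i}"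
      using ex by blast
    have "I \<subseteq> A \<inter> {..<Suc (Max I)}"
      using I by (auto simp: less_Suc_eq_le)
    then have "y \<in> C \<inter> (\<Inter>i\<in>I. ?K i)"
      using y by blast
    then show "C \<inter> (\<Inter>i\<in>I. ?K i) \<noteq> {}"
      by blast
  qed
  then show ?thesis
    by blast
qed

text \<open>The set \<open>G n\<close> consists of the sets contained in no member of the \<open>n\<close>-th of the closed sets
  whose union is \<open>J\<close>. A positive \<open>A\<close> belongs to each \<open>G n\<close>, since \<open>J\<close> is closed under subsets, and by
  compactness this is already witnessed by a finite part of \<open>A\<close>.\<close>

lemma F_sigma_ideal_positive_iff:
  assumes J: "ideal_on UNIV J" and "F_sigma_family J"
  obtains G :: "nat \<Rightarrow> nat set set"
  where "\<And>n s t. s \<in> G n \<Longrightarrow> s \<subseteq> t \<Longrightarrow> t \<in> G n"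
    and "\<And>A. A \<notin> J \<longleftrightarrow> (\<forall>n. \<exists>k. A \<inter> {..<k} \<in> G n)"
proof -
  let ?chi = "\<lambda>A n. n \<in> A"
  obtain C :: "nat \<Rightarrow> (nat \<Rightarrow> bool) set"
    where C: "\<And>n. closed (C n)" and chi: "?chi ` J = (\<Union>n. C n)"
  proof -
    have "fsigma (?chi ` J)"
      using assms(2) unfolding F_sigma_family_def .
    then show thesis
      by cases (rule that)
  qed
  have C_J: "{i. y i} \<in> J" if y: "y \<in> C n" for y n
  proof -
    obtain A where "A \<in> J" "y = ?chi A"
      using y chi by blast
    then show ?thesis
      by simp
  qed
  define G where "G n = {s. \<forall>y\<in>C n. \<not> s \<subseteq> {i. y i}}" for n
  show thesis
  proof
    show "t \<in> G n" if "s \<in> G n" "s \<subseteq> t" for n s t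
      using that unfolding G_def by blast
    show "A \<notin> J \<longleftrightarrow> (\<forall>n. \<exists>k. A \<inter> {..<k} \<in> G n)" for A
    proof
      assume A: "A \<notin> J"
      show "\<forall>n. \<exists>k. A \<inter> {..<k} \<in> G n"
      proof (rule ccontr)
        assume "\<not> (\<forall>n. \<exists>k. A \<inter> {..<k} \<in> G n)"
        then obtain n where "\<And>k. A \<inter> {..<k} \<notin> G n"
          by blast
        then have "\<exists>y\<in>C n. A \<inter> {..<k} \<subseteq> {i. y i}" for k
          unfolding G_def by simp
        then have "\<exists>y\<in>C n. A \<subseteq> {i. y i}"
          by (rule closed_family_superset[OF C])
        then obtain y where "A \<subseteq> {i. y i}" "{i. y i} \<in> J"
          using C_J by blast
        then show False
          using A ideal_on_subset[OF J] by blast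
      qed
    next
      assume *: "\<forall>n. \<exists>k. A \<inter> {..<k} \<in> G n"
      show "A \<notin> J"
      proof
        assume "A \<in> J"
        then obtain n where "?chi A \<in> C n"
          using chi by blast
        moreover obtain k where "A \<inter> {..<k} \<in> G n"
          using * by blast
        ultimately have "\<not> A \<inter> {..<k} \<subseteq> {i. ?chi A i}"
          unfolding G_def mem_Collect_eq by (rule bspec[rotated])
        then show False
          by simp
      qed
    qed
  qed
qed

text \<open>Transported to \<open>\<omega>\<close> by \<open>set_encode\<close>, the family consists of the sets \<open>{s. s \<subseteq> A}\<close> of finite
  \<open>s\<close>, for \<open>A\<close> in \<open>F\<close>, and the countably many conditions \<open>G n\<close>. Its finite intersections contain all long
  enough initial segments of a positive set. If \<open>P\<close> is a pseudointersection, then almost all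
  members of \<open>P\<close> are subsets of a given \<open>A\<close>, so the union of \<open>P\<close> is almost contained in \<open>A\<close>; and \<open>P\<close>
  has a member in each \<open>G n\<close>, so its union is positive.\<close>

lemma F_sigma_lower_bound_mod:
  assumes p: "pseudointersection_number =o continuum"
    and J: "ideal_on UNIV J" and Fs: "F_sigma_family J"
    and small: "|F| <o continuum" and F: "positive_FIP J F"
  shows "has_lower_bound_mod J F"
proof -
  obtain G :: "nat \<Rightarrow> nat set set"
    where G_mono: "\<And>n s t. s \<in> G n \<Longrightarrow> s \<subseteq> t \<Longrightarrow> t \<in> G n"
      and G: "\<And>A. A \<notin> J \<longleftrightarrow> (\<forall>n. \<exists>k. A \<inter> {..<k} \<in> G n)"
    using F_sigma_ideal_positive_iff[OF J Fs] by blast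
  define E where "E A = {c. set_decode c \<subseteq> A}" for A
  define H where "H n = {c. set_decode c \<in> G n}" for n
  let ?F = "E ` F \<union> range H"
  have "strong_FIP ?F"
    unfolding strong_FIP_def
  proof (intro allI impI, elim conjE)
    fix K assume K: "K \<subseteq> ?F" "finite K"
    have "finite (K \<inter> E ` F)" "finite (K \<inter> range H)"
      using K(2) by auto
    obtain S where S: "S \<subseteq> F" "finite S" "K \<inter> E ` F = E ` S"
      using finite_subset_image[OF \<open>finite (K \<inter> E ` F)\<close>] by (metis Int_lower2)
    obtain N where N: "finite N" "K \<inter> range H = H ` N"
      using finite_subset_image[OF \<open>finite (K \<inter> range H)\<close>] by (metis Int_lower2)
    define A where "A = \<Inter>S"
    have A: "A \<notin> J"
      using F S unfolding positive_FIP_def A_def by blast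
    then obtain k where k: "\<And>n. A \<inter> {..<k n} \<in> G n"
      using G by metis
    define m where "m = Max (k ` N)"
    have m: "A \<inter> {..<l} \<in> G n" if "n \<in> N" "m \<le> l" for n l
    proof (rule G_mono[OF k])
      have "k n \<le> m"
        using that(1) N(1) unfolding m_def by simp
      then show "A \<inter> {..<k n} \<subseteq> A \<inter> {..<l}"
        using that(2) by auto
    qed
    have "K = (K \<inter> E ` F) \<union> (K \<inter> range H)"
      using K(1) by blast
    then have K_eq: "K = E ` S \<union> H ` N"
      unfolding S(3) N(2) .
    let ?c = "\<lambda>l. set_encode (A \<inter> {..<l})"
    have "?c ` {m..} \<subseteq> \<Inter>K"
    proof clarify
      fix l X assume "m \<le> l" "X \<in> K"
      then have "X \<in> E ` S \<or> X \<in> H ` N"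
        unfolding K_eq by blast
      then show "?c l \<in> X"
        using m \<open>m \<le> l\<close> unfolding E_def H_def A_def by auto
    qed
    moreover have "infinite (?c ` {m..})"
    proof
      assume fin: "finite (?c ` {m..})"
      have "finite (\<Union>(set_decode ` ?c ` {m..}))"
      proof (rule finite_UN_I[OF fin])
        show "finite (set_decode c)" for c
          by (rule finite_set_decode)
      qed
      moreover have "A \<subseteq> \<Union>(set_decode ` ?c ` {m..})"
      proof
        fix a assume "a \<in> A"
        then have "a \<in> set_decode (?c (m + Suc a))"
          by simp
        moreover have "m + Suc a \<in> {m..}"
          by simp
        ultimately show "a \<in> \<Union>(set_decode ` ?c ` {m..})"
          by blast
      qed
      ultimately show False
        using A ideal_on_UNIV_finite[OF J] finite_subset by blast
    qed
    ultimately show "infinite (\<Inter>K)"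
      using infinite_super by blast
  qed
  moreover have "|?F| <o continuum"
    unfolding continuum_eq
  proof (rule card_of_Un_ordLess_infinite)
    show "infinite (UNIV :: (nat \<Rightarrow> bool) set)"
      by (simp add: finite_UNIV_fun)
    show "|E ` F| <o |UNIV :: (nat \<Rightarrow> bool) set|"
      using ordLeq_ordLess_trans[OF card_of_image small] unfolding continuum_eq .
    have "|range H| \<le>o natLeq"
      using countable_card_le_natLeq by blast
    moreover have "natLeq <o continuum"
      unfolding continuum_def by (rule ordLess_ctwo_cexp[OF natLeq_Card_order])
    ultimately show "|range H| <o |UNIV :: (nat \<Rightarrow> bool) set|"
      unfolding continuum_eq by (rule ordLeq_ordLess_trans)
  qed
  then have "\<not> pseudointersection_number \<le>o |?F|"
    using p by (meson not_ordLess_ordLeq ordIso_symmetric ordLess_ordIso_trans)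
  ultimately have "has_pseudointersection ?F"
    using pseudointersection_number(2)[of ?F] by metis
  then obtain P where P: "infinite P" "\<And>X. X \<in> ?F \<Longrightarrow> finite (P - X)"
    unfolding has_pseudointersection_def by metis
  define B where "B = \<Union>(set_decode ` P)"
  have "\<exists>k. B \<inter> {..<k} \<in> G n" for n
  proof -
    have "\<not> P \<subseteq> P - H n"
      using P(1) P(2)[of "H n"] finite_subset by blast
    then obtain c where c: "c \<in> P" "set_decode c \<in> G n"
      unfolding H_def by blast
    obtain k where "set_decode c \<subseteq> {..<k}"
      using finite_nat_bounded[OF finite_set_decode] by blast
    then have "set_decode c \<subseteq> B \<inter> {..<k}"
      using c(1) unfolding B_def by blast
    then show ?thesis
      using G_mono[OF c(2)] by blast
  qed
  then have "B \<notin> J"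
    using G by blast
  moreover have "B - A \<in> J" if "A \<in> F" for A
  proof -
    have "B - A \<subseteq> \<Union>(set_decode ` (P - E A))"
      unfolding B_def E_def by blast
    moreover have "finite (\<Union>(set_decode ` (P - E A)))"
      using P(2)[of "E A"] that by auto
    ultimately show ?thesis
      using ideal_on_UNIV_finite[OF J] finite_subset by blast
  qed
  ultimately show ?thesis
    unfolding has_lower_bound_mod_def by blast
qed

section \<open>The transfinite construction\<close>

lemma card_nat_fun_le_continuum: "|UNIV :: (nat \<Rightarrow> nat) set| \<le>o continuum"
  unfolding continuum_eq
proof (rule card_of_ordLeqI)
  let ?graph = "\<lambda>(f :: nat \<Rightarrow> nat) k. f (fst (prod_decode k)) = snd (prod_decode k)"
  show "inj ?graph"
  proof (rule injI)
    fix f g :: "nat \<Rightarrow> nat" assume "?graph f = ?graph g"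
    then have "?graph f (prod_encode (n, f n)) = ?graph g (prod_encode (n, f n))" for n
      by (rule fun_cong)
    then show "f = g"
      by (intro ext) simp
  qed
qed simp

text \<open>The transfinite recursion meets one requirement for each \<open>f :: nat \<Rightarrow> nat\<close>: the set \<open>A f\<close> decides
  \<open>f -` {0}\<close>, and \<open>f\<close> is injective on it if it is finite-to-one. As every subset of \<open>\<omega>\<close> is
  \<open>f -` {0}\<close> for some \<open>f\<close>, the sets \<open>A f\<close> generate, modulo \<open>J\<close>, an ultrafilter, and it is a
  Q-point.\<close>

lemma ex_Q_point_disjoint_ideal:
  assumes J: "ideal_on UNIV J"
    and lower: "\<And>F. |F| <o continuum \<Longrightarrow> positive_FIP J F \<Longrightarrow> has_lower_bound_mod J F"
    and step: "\<And>B (f :: nat \<Rightarrow> nat). B \<notin> J \<Longrightarrow> finite_to_one f \<Longrightarrow>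
      \<exists>C\<subseteq>B. C \<notin> J \<and> inj_on f C"
  shows "\<exists>U. Q_point U \<and> U \<inter> J = {}"
proof -
  let ?r = "|UNIV :: (nat \<Rightarrow> nat) set|"
  have wo: "well_order_on UNIV ?r"
    by (rule card_of_well_order_on)
  then have wf: "wf (?r - Id)"
    unfolding well_order_on_def by blast
  have lin: "(s, t) \<in> ?r \<or> (t, s) \<in> ?r" for s t
    using wo unfolding well_order_on_def linear_order_on_def partial_order_on_def
      preorder_on_def total_on_def refl_on_def by (metis UNIV_I)
  have trans: "(s, u) \<in> ?r" if "(s, t) \<in> ?r" "(t, u) \<in> ?r" for s t u
    using wo that unfolding well_order_on_def linear_order_on_def partial_order_on_def
      preorder_on_def trans_def by blast
  define good where "good f C \<longleftrightarrow>
    (C \<subseteq> f -` {0} \<or> C \<inter> f -` {0} = {}) \<and> (finite_to_one f \<longrightarrow> inj_on f C)"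
    for f :: "nat \<Rightarrow> nat" and C
  have ex_good: "\<exists>C\<subseteq>B. C \<notin> J \<and> good f C" if B: "B \<notin> J" for B f
  proof -
    have "B = (B \<inter> f -` {0}) \<union> (B - f -` {0})"
      by blast
    then obtain D where D: "D \<subseteq> B" "D \<notin> J" "D \<subseteq> f -` {0} \<or> D \<inter> f -` {0} = {}"
      using ideal_on_Un[OF J, of "B \<inter> f -` {0}" "B - f -` {0}"] B
      by (metis Diff_disjoint Diff_subset Int_commute Int_lower1 Int_lower2)
    show ?thesis
    proof (cases "finite_to_one f")
      case True
      then obtain C where "C \<subseteq> D" "C \<notin> J" "inj_on f C"
        using step[OF D(2)] by blast
      then show ?thesis
        using D unfolding good_def by (intro exI[of _ C]) blast
    next
      case False
      then show ?thesis
        using D unfolding good_def by blast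
    qed
  qed
  \<comment> \<open>The witness is the largest of the finitely many indices: its set is contained, modulo \<open>J\<close>, in
    all the others.\<close>
  have FIP: "\<exists>t\<in>S. A t - (\<Inter>s\<in>S. A s) \<in> J"
    if "finite S" "S \<noteq> {}" and dec: "\<And>s t. t \<in> S \<Longrightarrow> (s, t) \<in> ?r - Id \<Longrightarrow> A t - A s \<in> J"
    for S and A :: "(nat \<Rightarrow> nat) \<Rightarrow> nat set"
  proof -
    have "\<exists>t\<in>S. \<forall>s\<in>S. (s, t) \<in> ?r"
      using that(1,2)
    proof (induction S rule: finite_ne_induct)
      case (singleton x)
      then show ?case
        using lin by blast
    next
      case (insert x S)
      then show ?case
        using lin trans by (metis insert_iff)
    qed
    then obtain t where t: "t \<in> S" "\<And>s. s \<in> S \<Longrightarrow> (s, t) \<in> ?r"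
      by blast
    have "A t - A s \<in> J" if "s \<in> S" for s
    proof (cases "s = t")
      case True
      then show ?thesis
        using ideal_on_UNIV_finite[OF J, of "{}"] by simp
    next
      case False
      then show ?thesis
        using dec[OF t(1), of s] t(2)[OF that] by blast
    qed
    then have "(\<Union>s\<in>S. A t - A s) \<in> J"
      by (rule ideal_on_UN[OF J that(1)])
    then show ?thesis
    proof (intro bexI)
      have "A t - (\<Inter>s\<in>S. A s) = (\<Union>s\<in>S. A t - A s)"
        by blast
      then show "A t - (\<Inter>s\<in>S. A s) \<in> J"
        using \<open>(\<Union>s\<in>S. A t - A s) \<in> J\<close> by simp
    qed (rule t(1))
  qed
  have "\<exists>A. \<forall>f. A f \<notin> J \<and> good f (A f) \<and> (\<forall>g. (g, f) \<in> ?r - Id \<longrightarrow> A f - A g \<in> J)"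
  proof (rule dependent_wf_choice[OF wf])
    show "(C \<notin> J \<and> good x C \<and> (\<forall>g'. (g', x) \<in> ?r - Id \<longrightarrow> C - f g' \<in> J)) =
        (C \<notin> J \<and> good x C \<and> (\<forall>g'. (g', x) \<in> ?r - Id \<longrightarrow> C - g g' \<in> J))"
      if "\<And>z. (z, x) \<in> ?r - Id \<Longrightarrow> f z = g z" for f g x C
      using that by auto
  next
    fix f A
    assume A: "\<And>g. (g, f) \<in> ?r - Id \<Longrightarrow>
      A g \<notin> J \<and> good g (A g) \<and> (\<forall>h. (h, g) \<in> ?r - Id \<longrightarrow> A g - A h \<in> J)"
    define L where "L = underS ?r f"
    have L: "(g, f) \<in> ?r - Id" if "g \<in> L" for g
      using that unfolding L_def underS_def by blast
    have "|L| <o ?r"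
      unfolding L_def by (rule card_of_underS[OF card_of_Card_order]) (simp add: Field_card_of)
    then have "|A ` L| <o continuum"
      using card_nat_fun_le_continuum
      by (meson card_of_image ordLeq_ordLess_trans ordLess_ordLeq_trans)
    moreover have "positive_FIP J (A ` L)"
      unfolding positive_FIP_def
    proof (intro allI impI, elim conjE)
      fix K assume "K \<subseteq> A ` L" "finite K"
      then obtain S where S: "S \<subseteq> L" "finite S" "K = A ` S"
        using finite_subset_image by metis
      show "\<Inter>K \<notin> J"
      proof (cases "S = {}")
        case True
        then show ?thesis
          using S(3) ideal_on_UNIV_notin[OF J] by simp
      next
        case False
        have "A t - A s \<in> J" if "t \<in> S" "(s, t) \<in> ?r - Id" for s t
          using A[OF L] S(1) that by blast
        then obtain t where t: "t \<in> S" "A t - \<Inter>K \<in> J"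
          using FIP[OF S(2) False, of A] unfolding S(3) by blast
        then have "A t \<notin> J"
          using A L S(1) by blast
        moreover have "A t \<subseteq> (A t - \<Inter>K) \<union> \<Inter>K"
          by blast
        ultimately show ?thesis
          using ideal_on_Un[OF J t(2)] ideal_on_subset[OF J] by blast
      qed
    qed
    ultimately obtain B where B: "B \<notin> J" "\<And>g. g \<in> L \<Longrightarrow> B - A g \<in> J"
      using lower unfolding has_lower_bound_mod_def by blast
    obtain C where C: "C \<subseteq> B" "C \<notin> J" "good f C"
      using ex_good[OF B(1)] by blast
    have "C - A g \<in> J" if "(g, f) \<in> ?r - Id" for g
    proof (rule ideal_on_subset[OF J B(2)])
      show "g \<in> L"
        using that unfolding L_def underS_def by blast
      show "C - A g \<subseteq> B - A g"
        using C(1) by blast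
    qed
    then show "\<exists>C. C \<notin> J \<and> good f C \<and> (\<forall>g. (g, f) \<in> ?r - Id \<longrightarrow> C - A g \<in> J)"
      using C by blast
  qed
  then obtain A where
    "\<forall>f. A f \<notin> J \<and> good f (A f) \<and> (\<forall>g. (g, f) \<in> ?r - Id \<longrightarrow> A f - A g \<in> J)" ..
  then have A: "A f \<notin> J" "good f (A f)" "(g, f) \<in> ?r - Id \<Longrightarrow> A f - A g \<in> J" for f g
    by blast+
  define U where "U = {X. \<exists>f. A f - X \<in> J}"
  have A_U: "A f \<in> U" for f
    unfolding U_def using ideal_on_UNIV_finite[OF J, of "{}"] by (auto intro: exI[of _ f])
  have U_mono: "Y \<in> U" if X: "X \<in> U" "X \<subseteq> Y" for X Y
  proof -
    obtain f where "A f - X \<in> J"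
      using X(1) unfolding U_def by blast
    moreover have "A f - Y \<subseteq> A f - X"
      using X(2) by blast
    ultimately have "A f - Y \<in> J"
      by (rule ideal_on_subset[OF J])
    then show ?thesis
      unfolding U_def by blast
  qed
  have disj: "X \<notin> J" if X: "X \<in> U" for X
  proof
    assume "X \<in> J"
    obtain f where "A f - X \<in> J"
      using X unfolding U_def by blast
    moreover have "A f \<subseteq> (A f - X) \<union> X"
      by blast
    ultimately show False
      using A(1) ideal_on_Un[OF J] ideal_on_subset[OF J] \<open>X \<in> J\<close> by blast
  qed
  have U: "ultrafilter U"
    unfolding ultrafilter_def
  proof (intro conjI ballI allI impI)
    show "{} \<notin> U"
      using disj ideal_on_UNIV_finite[OF J] by blast
  next
    fix X Y assume "X \<in> U" "Y \<in> U"
    then obtain f g where fg: "A f - X \<in> J" "A g - Y \<in> J"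
      unfolding U_def by blast
    obtain t where t: "A t - (A f \<inter> A g) \<in> J"
      using FIP[of "{f, g}" A] A(3) by auto
    have "A t - (X \<inter> Y) \<subseteq> (A t - (A f \<inter> A g)) \<union> (A f - X) \<union> (A g - Y)"
      by blast
    then have "A t - (X \<inter> Y) \<in> J"
      using ideal_on_subset[OF J ideal_on_Un[OF J ideal_on_Un[OF J t fg(1)] fg(2)]] by blast
    then show "X \<inter> Y \<in> U"
      unfolding U_def by blast
  next
    show "Y \<in> U" if "X \<in> U" "X \<subseteq> Y" for X Y
      using U_mono that .
  next
    fix X :: "nat set"
    define f where "f n = (if n \<in> X then 0 else 1 :: nat)" for n
    have "f -` {0} = X"
      unfolding f_def by auto
    then have "A f \<subseteq> X \<or> A f \<subseteq> - X"
      using A(2)[of f] unfolding good_def by auto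
    then show "X \<in> U \<or> - X \<in> U"
      using U_mono A_U by blast
  next
    fix X :: "nat set" assume "finite (- X)"
    then have "A f - X \<in> J" for f
      using ideal_on_UNIV_finite[OF J] by (simp add: Diff_eq)
    then show "X \<in> U"
      unfolding U_def by blast
  qed
  moreover have "\<exists>S\<in>U. inj_on f S" if "finite_to_one f" for f :: "nat \<Rightarrow> nat"
    using A(2)[of f] A_U that unfolding good_def by blast
  ultimately have "Q_point U"
    unfolding Q_point_iff_inj_on by blast
  then show ?thesis
    using disj by blast
qed

lemma ED_Fin_Q_point_equivalences:
  assumes J: "ideal_on UNIV J" and hom: "KB_homogeneous UNIV J"
    and lower: "\<And>F. |F| <o continuum \<Longrightarrow> positive_FIP J F \<Longrightarrow> has_lower_bound_mod J F"
  shows "(\<not> KB_le Delta ED_Fin UNIV J \<longleftrightarrow> (\<exists>U. Q_point U \<and> \<not> ideal_point J U)) \<and>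
    ((\<exists>U. Q_point U \<and> \<not> ideal_point J U) \<longleftrightarrow> (\<exists>U. Q_point U \<and> \<not> weak_ultrafilter J U))"
proof (intro conjI iffI)
  assume "\<not> KB_le Delta ED_Fin UNIV J"
  then obtain U where U: "Q_point U" "U \<inter> J = {}"
    using ex_Q_point_disjoint_ideal[OF J lower] positive_subset_inj_on[OF J hom] by metis
  then have "ultrafilter U"
    unfolding Q_point_def by blast
  then have "- B \<in> U" if "B \<in> J" for B
    using ultrafilter_Compl U(2) that by blast
  then have "P_le UNIV J UNIV (dual_ideal U)"
    unfolding P_le_UNIV dual_ideal_iff by (intro exI[of _ "\<lambda>x. x"]) simp
  then show "\<exists>U. Q_point U \<and> \<not> ideal_point J U"
    using U(1) unfolding ideal_point_def by blast
next
  assume "\<exists>U. Q_point U \<and> \<not> ideal_point J U"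
  then obtain U where U: "Q_point U" "\<not> weak_ultrafilter J U"
    using Q_point_ideal_point_iff_weak by blast
  then have "KB_le UNIV J UNIV (dual_ideal U)"
    unfolding weak_ultrafilter_def Q_point_def by blast
  then show "\<not> KB_le Delta ED_Fin UNIV J"
    using KB_le_trans Q_point_not_above_ED_Fin[OF U(1)] by blast
qed (use Q_point_ideal_point_iff_weak in blast)+

theorem theorem8p5:
  fixes J :: "nat set set"
  assumes "ideal_on UNIV J"
    and "P_plus_ideal UNIV J"
    and "KB_homogeneous UNIV J"
  shows
    "(CH \<longrightarrow>
        (\<not> KB_le Delta ED_Fin UNIV J \<longleftrightarrow> (\<exists>U. Q_point U \<and> \<not> ideal_point J U)) \<and>
        ((\<exists>U. Q_point U \<and> \<not> ideal_point J U) \<longleftrightarrow> (\<exists>U. Q_point U \<and> \<not> weak_ultrafilter J U))) \<and>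
     (F_sigma_family J \<and> pseudointersection_number =o continuum \<longrightarrow>
        (\<not> KB_le Delta ED_Fin UNIV J \<longleftrightarrow> (\<exists>U. Q_point U \<and> \<not> ideal_point J U)) \<and>
        ((\<exists>U. Q_point U \<and> \<not> ideal_point J U) \<longleftrightarrow> (\<exists>U. Q_point U \<and> \<not> weak_ultrafilter J U)))"
proof (intro conjI[of "CH \<longrightarrow> _"] impI)
  assume "CH"
  show "(\<not> KB_le Delta ED_Fin UNIV J \<longleftrightarrow> (\<exists>U. Q_point U \<and> \<not> ideal_point J U)) \<and>
    ((\<exists>U. Q_point U \<and> \<not> ideal_point J U) \<longleftrightarrow> (\<exists>U. Q_point U \<and> \<not> weak_ultrafilter J U))"
    using ED_Fin_Q_point_equivalences[OF assms(1,3)] CH_lower_bound_mod[OF \<open>CH\<close> assms(1,2)]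
    by blast
next
  assume "F_sigma_family J \<and> pseudointersection_number =o continuum"
  then show "(\<not> KB_le Delta ED_Fin UNIV J \<longleftrightarrow> (\<exists>U. Q_point U \<and> \<not> ideal_point J U)) \<and>
    ((\<exists>U. Q_point U \<and> \<not> ideal_point J U) \<longleftrightarrow> (\<exists>U. Q_point U \<and> \<not> weak_ultrafilter J U))"
    using ED_Fin_Q_point_equivalences[OF assms(1,3)] F_sigma_lower_bound_mod[OF _ assms(1)]
    by blast
qed

end
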